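(* Let $X$ be a chain and let $\alpha,\beta\in\mathcal{OP}(X)$. Then $\alpha\,\mathcal{L}\,\beta$ in $\mathcal{OP}(X)$ if and only if $\mathrm{Im}(\alpha)=\mathrm{Im}(\beta)$.
   Context: $X$ is a chain (totally ordered set), finite or infinite. Maps are written on the right and composed from left to right: $x(\alpha\beta)=(x\alpha)\beta$. A full transformation $\alpha:X\to X$ is orientation-preserving if it is the empty transformation (only when $X=\emptyset$) or there exists a non-empty subset $Y$ of $X$ such that: (OP1) $\alpha$ is order-preserving (i.e. $x\le y$ implies $x\alpha\le y\alpha$) both on $Y$ and on $X\setminus Y$; (OP2) for all $a\in Y$ and $b\in X\setminus Y$, $a\le b$ and $a\alpha\ge b\alpha$. $\mathcal{OP}(X)$ is the monoid, under composition, of all orientation-preserving full transformations of $X$. Green's relation $\mathcal{L}$ on a monoid $S$: $\alpha\,\mathcal{L}\,\beta$ iff $S\alpha=S\beta$, i.e. $\alpha=\gamma\beta$ and $\beta=\lambda\alpha$ for some $\gamma,\lambda\in S$. *)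

theory Defs
  imports "HOL-Algebra.Group" "HOL-Library.FuncSet"
begin

text \<open>
  A chain is a subset \<open>X\<close>, possibly empty, of a linearly ordered type. Full transformations
  of \<open>X\<close> are the members of \<open>X \<rightarrow>\<^sub>E X\<close>: they are made extensional so that equality of elements of
  the monoid is equality of maps on \<open>X\<close>.
\<close>

definition orientation_preserving_on :: "'a::linorder set \<Rightarrow> ('a \<Rightarrow> 'a) \<Rightarrow> bool" where
  "orientation_preserving_on X f \<longleftrightarrow>
     X = {} \<or>
     (\<exists>Y. Y \<noteq> {} \<and> Y \<subseteq> X \<and>
          mono_on Y f \<and> mono_on (X - Y) f \<and>
          (\<forall>a\<in>Y. \<forall>b\<in>X - Y. a \<le> b \<and> f a \<ge> f b))"

definition OP_set :: "'a::linorder set \<Rightarrow> ('a \<Rightarrow> 'a) set" where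
  "OP_set X = {f \<in> X \<rightarrow>\<^sub>E X. orientation_preserving_on X f}"

text \<open>Maps act on the right, so the product \<open>f \<otimes> g\<close> applies \<open>f\<close> first.\<close>

definition OP :: "'a::linorder set \<Rightarrow> ('a \<Rightarrow> 'a) monoid" where
  "OP X = \<lparr>carrier = OP_set X, mult = (\<lambda>f g. compose X g f), one = (\<lambda>x\<in>X. x)\<rparr>"

definition green_L :: "('s, 'b) monoid_scheme \<Rightarrow> 's \<Rightarrow> 's \<Rightarrow> bool" where
  "green_L S a b \<longleftrightarrow>
     a \<in> carrier S \<and> b \<in> carrier S \<and>
     {s \<otimes>\<^bsub>S\<^esub> a | s. s \<in> carrier S} = {s \<otimes>\<^bsub>S\<^esub> b | s. s \<in> carrier S}"

lemma (in monoid) green_L_iff: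
  assumes "a \<in> carrier G" "b \<in> carrier G"
  shows "green_L G a b \<longleftrightarrow>
           (\<exists>c\<in>carrier G. a = c \<otimes> b) \<and> (\<exists>d\<in>carrier G. b = d \<otimes> a)"
proof
  assume L: "green_L G a b"
  have "a \<in> {s \<otimes> a | s. s \<in> carrier G}" "b \<in> {s \<otimes> b | s. s \<in> carrier G}"
    using assms l_one one_closed by (metis (mono_tags, lifting) mem_Collect_eq)+
  with L show "(\<exists>c\<in>carrier G. a = c \<otimes> b) \<and> (\<exists>d\<in>carrier G. b = d \<otimes> a)"
    unfolding green_L_def by blast
next
  assume "(\<exists>c\<in>carrier G. a = c \<otimes> b) \<and> (\<exists>d\<in>carrier G. b = d \<otimes> a)"
  then obtain c d where c: "c \<in> carrier G" "a = c \<otimes> b" and d: "d \<in> carrier G" "b = d \<otimes> a"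
    by blast
  have "s \<otimes> a = (s \<otimes> c) \<otimes> b" "s \<otimes> b = (s \<otimes> d) \<otimes> a" if "s \<in> carrier G" for s
    using that assms c d m_assoc by metis+
  moreover have "s \<otimes> c \<in> carrier G" "s \<otimes> d \<in> carrier G" if "s \<in> carrier G" for s
    using that c d by auto
  ultimately show "green_L G a b"
    unfolding green_L_def using assms by blast
qed

lemma orientation_preserving_on_compose:
  assumes f: "f \<in> X \<rightarrow> X" "orientation_preserving_on X f"
    and g: "orientation_preserving_on X g"
  shows "orientation_preserving_on X (compose X g f)"
proof (cases "X = {}")
  case True
  then show ?thesis by (simp add: orientation_preserving_on_def)
next
  case False
  obtain A where A: "A \<noteq> {}" "A \<subseteq> X" "mono_on A f" "mono_on (X - A) f"
    "\<And>a b. a \<in> A \<Longrightarrow> b \<in> X - A \<Longrightarrow> a \<le> b \<and> f b \<le> f a"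
    using f False unfolding orientation_preserving_on_def by blast
  obtain Z where Z: "Z \<noteq> {}" "Z \<subseteq> X" "mono_on Z g" "mono_on (X - Z) g"
    "\<And>a b. a \<in> Z \<Longrightarrow> b \<in> X - Z \<Longrightarrow> a \<le> b \<and> g b \<le> g a"
    using g False unfolding orientation_preserving_on_def by blast
  have fX: "\<And>x. x \<in> X \<Longrightarrow> f x \<in> X" using f by auto
  have mA: "\<And>x y. x \<in> A \<Longrightarrow> y \<in> A \<Longrightarrow> x \<le> y \<Longrightarrow> f x \<le> f y"
    and mB: "\<And>x y. x \<in> X - A \<Longrightarrow> y \<in> X - A \<Longrightarrow> x \<le> y \<Longrightarrow> f x \<le> f y"
    and mZ: "\<And>x y. x \<in> Z \<Longrightarrow> y \<in> Z \<Longrightarrow> x \<le> y \<Longrightarrow> g x \<le> g y"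
    and mW: "\<And>x y. x \<in> X - Z \<Longrightarrow> y \<in> X - Z \<Longrightarrow> x \<le> y \<Longrightarrow> g x \<le> g y"
    using A Z by (auto simp: monotone_on_def)
  have down: "x \<in> Z" if "x \<le> y" "y \<in> Z" "x \<in> X" for x y
    using that Z(5)[of y x] by fastforce
  define Y where "Y = (if \<exists>a\<in>A. f a \<in> Z then {a \<in> A. f a \<in> Z}
                       else A \<union> {b \<in> X - A. f b \<in> Z})"
  have low: "f b \<in> Z" if "a \<in> A" "f a \<in> Z" "b \<in> X - A" for a b
    using that A(5) down fX by blast
  have "Y \<noteq> {}" "Y \<subseteq> X" using A by (auto simp: Y_def)
  moreover have "g (f x) \<le> g (f y)" if xy: "x \<in> Y" "y \<in> Y" "x \<le> y" for x y
  proof (cases "\<exists>a\<in>A. f a \<in> Z")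
    case True
    then show ?thesis using xy mA mZ by (auto simp: Y_def)
  next
    case False
    consider "x \<in> A" "y \<in> A" | "x \<in> A" "y \<in> X - A" "f y \<in> Z"
      | "x \<in> X - A" "y \<in> A" "f x \<in> Z" | "x \<in> X - A" "y \<in> X - A" "f x \<in> Z" "f y \<in> Z"
      using xy False by (auto simp: Y_def)
    then show ?thesis
    proof cases
      case 1
      then show ?thesis using False mA mW fX xy A(2) by blast
    next
      case 2
      then show ?thesis using False Z(5) fX A(2) by blast
    next
      case 3
      then show ?thesis using A(5) xy(3) by (metis order.antisym order.refl Diff_iff)
    next
      case 4
      then show ?thesis using mB mZ xy by blast
    qed
  qed
  moreover have "g (f x) \<le> g (f y)" if xy: "x \<in> X - Y" "y \<in> X - Y" "x \<le> y" for x y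
  proof (cases "\<exists>a\<in>A. f a \<in> Z")
    case True
    then obtain a where a: "a \<in> A" "f a \<in> Z" by blast
    consider "x \<in> A" "y \<in> A" "f x \<notin> Z" "f y \<notin> Z" | "x \<in> A" "y \<in> X - A" "f x \<notin> Z"
      | "x \<in> X - A" "y \<in> A" | "x \<in> X - A" "y \<in> X - A"
      using xy True by (auto simp: Y_def)
    then show ?thesis
    proof cases
      case 1
      then show ?thesis using mA mW fX xy by blast
    next
      case 2
      then show ?thesis using low[OF a] Z(5) fX xy by blast
    next
      case 3
      then show ?thesis using A(5) xy(3) by (metis order.antisym order.refl Diff_iff)
    next
      case 4
      then show ?thesis using low[OF a] mB mZ xy by blast
    qed
  next
    case False
    then have "x \<in> X - A" "y \<in> X - A" "f x \<notin> Z" "f y \<notin> Z" using xy by (auto simp: Y_def)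
    then show ?thesis using mB mW fX xy by blast
  qed
  moreover have "a \<le> b \<and> g (f b) \<le> g (f a)" if "a \<in> Y" "b \<in> X - Y" for a b
  proof (cases "\<exists>a\<in>A. f a \<in> Z")
    case True
    then have a: "a \<in> A" "f a \<in> Z" using that by (auto simp: Y_def)
    show ?thesis
    proof (cases "b \<in> A")
      case bA: True
      then have b: "f b \<notin> Z" using that True by (auto simp: Y_def)
      then have "\<not> b \<le> a" using mA[OF bA a(1)] down[OF _ a(2)] fX that by blast
      then show ?thesis using Z(5) a b fX that by force
    next
      case False
      then show ?thesis using low[OF a] A(5) a mZ that by blast
    qed
  next
    case False
    then have b: "b \<in> X - A" "f b \<notin> Z" using that by (auto simp: Y_def)
    show ?thesis
    proof (cases "a \<in> A")
      case True
      then show ?thesis using False A(2,5) b mW fX by blast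
    next
      case aA: False
      then have a: "a \<in> X - A" "f a \<in> Z" using that False by (auto simp: Y_def split: if_splits)
      then have "\<not> b \<le> a" using mB[OF b(1) a(1)] down[OF _ a(2)] fX b by blast
      then show ?thesis using Z(5) a b fX by force
    qed
  qed
  ultimately have "Y \<noteq> {} \<and> Y \<subseteq> X \<and> mono_on Y (compose X g f) \<and> mono_on (X - Y) (compose X g f) \<and>
      (\<forall>a\<in>Y. \<forall>b\<in>X - Y. a \<le> b \<and> compose X g f b \<le> compose X g f a)"
    by (auto simp: monotone_on_def compose_eq subset_iff)
  then show ?thesis unfolding orientation_preserving_on_def by blast
qed

lemma monoid_OP: "monoid (OP X)"
proof
  fix f g assume "f \<in> carrier (OP X)" "g \<in> carrier (OP X)"
  then have "f \<in> X \<rightarrow> X" "g \<in> X \<rightarrow> X" "orientation_preserving_on X f"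
    "orientation_preserving_on X g"
    by (auto simp: OP_def OP_set_def PiE_def)
  then show "f \<otimes>\<^bsub>OP X\<^esub> g \<in> carrier (OP X)"
    using orientation_preserving_on_compose funcset_compose[of f X X g X]
    by (auto simp: OP_def OP_set_def PiE_def)
next
  have "orientation_preserving_on X (\<lambda>x\<in>X. x)"
    unfolding orientation_preserving_on_def
    by (cases "X = {}") (auto simp: monotone_on_def intro!: exI[of _ X])
  then show "\<one>\<^bsub>OP X\<^esub> \<in> carrier (OP X)"
    by (auto simp: OP_def OP_set_def)
qed (auto simp: OP_def OP_set_def compose_def PiE_def Pi_def extensional_def restrict_def fun_eq_iff)

end

theory Submission
  imports Defs
begin

text \<open>
  If \<open>\<alpha> = \<gamma>\<beta>\<close> then clearly \<open>Im \<alpha> \<subseteq> Im \<beta>\<close>, so the point is the converse: whenever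
  \<open>Im \<alpha> \<subseteq> Im \<beta>\<close>, the map \<open>\<alpha>\<close> factors through \<open>\<beta>\<close> inside the monoid
  (\<open>left_multiple_iff_image_subset\<close>). Any section \<open>s\<close> of \<open>\<beta>\<close> on \<open>Im \<beta>\<close> gives a factorization
  \<open>\<alpha> = (\<alpha>s)\<beta>\<close> as maps. What must be arranged is that \<open>\<alpha>s\<close> preserves orientation.

  A section of a monotone map is monotone, and \<open>\<beta>\<close> consists of two monotone pieces: one on a
  lower part \<open>Y\<close> of \<open>X\<close> with the larger values, one on the rest with the smaller values. The
  two pieces have at most one value in common, so if the preimage of that value is always
  taken outside \<open>Y\<close>, the section is again made of two monotone pieces that are swapped, that is,
  orientation-preserving on the chain \<open>Im \<beta>\<close> (\<open>orientation_preserving_section\<close>).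

  In general \<open>s\<close> has no orientation-preserving extension to \<open>X\<close>: if \<open>x\<close> lies strictly between
  values of \<open>\<beta>\<close>, there may be no point of \<open>X\<close> between the chosen preimages of the values below
  and above \<open>x\<close>. Hence closure of the monoid under products does not apply to \<open>\<alpha>\<close> and \<open>s\<close>, and
  composition is treated for a second map that preserves orientation only on the image of the
  first (\<open>orientation_preserving_on_comp\<close>).
\<close>

text \<open>
  The two conditions on \<open>Y\<close> in the definition merge into one rule: \<open>Y\<close> is a lower part of \<open>X\<close>,
  and \<open>f\<close> reverses exactly the pairs that \<open>Y\<close> separates. Reversals can then be counted modulo
  two under composition. An empty \<open>Y\<close> may be allowed, since \<open>Y = {}\<close> and \<open>Y = X\<close> both say
  that \<open>f\<close> is monotone.
\<close>

lemma orientation_preserving_on_iff_reversal: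
  "orientation_preserving_on X f \<longleftrightarrow>
     (\<exists>Y. \<forall>x\<in>X. \<forall>y\<in>X. x \<le> y \<longrightarrow>
        (y \<in> Y \<longrightarrow> x \<in> Y) \<and>
        (if x \<in> Y \<longleftrightarrow> y \<in> Y then f x \<le> f y else f y \<le> f x))"
  (is "_ \<longleftrightarrow> (\<exists>Y. ?R Y)")
proof
  assume "orientation_preserving_on X f"
  then consider "X = {}" | Y where "Y \<subseteq> X" "mono_on Y f" "mono_on (X - Y) f"
      "\<forall>a\<in>Y. \<forall>b\<in>X - Y. a \<le> b \<and> f b \<le> f a"
    unfolding orientation_preserving_on_def by blast
  then show "\<exists>Y. ?R Y"
  proof cases
    case 1
    then show ?thesis by simp
  next
    case (2 Y)
    have "?R Y"
      using 2 unfolding monotone_on_def by (auto dest: order.antisym)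
    then show ?thesis ..
  qed
next
  assume "\<exists>Y. ?R Y"
  then obtain Y where Y: "?R Y"
    by blast
  then have
    lower: "\<And>x y. x \<in> X \<Longrightarrow> y \<in> X \<Longrightarrow> x \<le> y \<Longrightarrow> y \<in> Y \<Longrightarrow> x \<in> Y" and
    keeps: "\<And>x y. x \<in> X \<Longrightarrow> y \<in> X \<Longrightarrow> x \<le> y \<Longrightarrow> x \<in> Y \<longleftrightarrow> y \<in> Y \<Longrightarrow> f x \<le> f y" and
    swaps: "\<And>x y. x \<in> X \<Longrightarrow> y \<in> X \<Longrightarrow> x \<le> y \<Longrightarrow> \<not> (x \<in> Y \<longleftrightarrow> y \<in> Y) \<Longrightarrow> f y \<le> f x"
    by simp_all
  define Z where "Z = (if X \<inter> Y = {} then X else X \<inter> Y)"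
  have "mono_on Z f" "mono_on (X - Z) f"
    by (rule monotone_onI, rule keeps; force simp: Z_def split: if_splits)+
  moreover have "a \<le> b \<and> f b \<le> f a" if ab: "a \<in> Z" "b \<in> X - Z" for a b
  proof -
    have *: "a \<in> X" "a \<in> Y" "b \<in> X" "b \<notin> Y"
      using ab by (auto simp: Z_def split: if_splits)
    then have "a \<le> b" using lower linear by blast
    then show ?thesis using swaps * by blast
  qed
  moreover have "Z \<subseteq> X" "X = {} \<or> Z \<noteq> {}" by (auto simp: Z_def)
  ultimately show "orientation_preserving_on X f"
    unfolding orientation_preserving_on_def by blast
qed

text \<open>
  Let \<open>f\<close> and \<open>g\<close> reverse the pairs separated by \<open>A\<close> and by \<open>Z\<close>. Then \<open>g \<circ> f\<close> reverses a pair
  iff exactly one of \<open>A\<close> and the preimage of \<open>Z\<close> separates it, that is, iff their symmetric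
  difference \<open>D\<close> does. Since \<open>f\<close> maps \<open>A\<close> above \<open>X - A\<close> and \<open>Z\<close> is a lower part, \<open>f\<close> cannot
  take both a point of \<open>A\<close> into \<open>Z\<close> and a point of \<open>X - A\<close> outside \<open>Z\<close>. Going up in \<open>X\<close>, one
  therefore leaves or enters \<open>D\<close> at most once, and either \<open>D\<close> or its complement is a lower part.
\<close>

lemma orientation_preserving_on_comp:
  assumes "orientation_preserving_on X f" and "orientation_preserving_on (f ` X) g"
  shows "orientation_preserving_on X (g \<circ> f)"
proof -
  obtain A where A: "\<forall>x\<in>X. \<forall>y\<in>X. x \<le> y \<longrightarrow>
      (y \<in> A \<longrightarrow> x \<in> A) \<and> (if x \<in> A \<longleftrightarrow> y \<in> A then f x \<le> f y else f y \<le> f x)"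
    using assms(1) unfolding orientation_preserving_on_iff_reversal by blast
  then have
    A_lower: "\<And>x y. x \<in> X \<Longrightarrow> y \<in> X \<Longrightarrow> x \<le> y \<Longrightarrow> y \<in> A \<Longrightarrow> x \<in> A" and
    f_keeps: "\<And>x y. x \<in> X \<Longrightarrow> y \<in> X \<Longrightarrow> x \<le> y \<Longrightarrow> x \<in> A \<longleftrightarrow> y \<in> A \<Longrightarrow> f x \<le> f y" and
    f_swaps: "\<And>x y. x \<in> X \<Longrightarrow> y \<in> X \<Longrightarrow> x \<le> y \<Longrightarrow> \<not> (x \<in> A \<longleftrightarrow> y \<in> A) \<Longrightarrow> f y \<le> f x"
    by simp_all
  obtain Z where Z: "\<forall>v\<in>f ` X. \<forall>w\<in>f ` X. v \<le> w \<longrightarrow>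
      (w \<in> Z \<longrightarrow> v \<in> Z) \<and> (if v \<in> Z \<longleftrightarrow> w \<in> Z then g v \<le> g w else g w \<le> g v)"
    using assms(2) unfolding orientation_preserving_on_iff_reversal by blast
  then have
    Z_lower: "\<And>x y. x \<in> X \<Longrightarrow> y \<in> X \<Longrightarrow> f x \<le> f y \<Longrightarrow> f y \<in> Z \<Longrightarrow> f x \<in> Z" and
    g_keeps: "\<And>x y. x \<in> X \<Longrightarrow> y \<in> X \<Longrightarrow> f x \<le> f y \<Longrightarrow> f x \<in> Z \<longleftrightarrow> f y \<in> Z \<Longrightarrow> g (f x) \<le> g (f y)" and
    g_swaps: "\<And>x y. x \<in> X \<Longrightarrow> y \<in> X \<Longrightarrow> f x \<le> f y \<Longrightarrow> \<not> (f x \<in> Z \<longleftrightarrow> f y \<in> Z) \<Longrightarrow> g (f y) \<le> g (f x)"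
    by simp_all
  define D where "D = {x. \<not> (x \<in> A \<longleftrightarrow> f x \<in> Z)}"
  define Y where "Y = (if \<exists>a\<in>X. a \<in> A \<and> f a \<in> Z then - D else D)"
  have reversal: "if x \<in> D \<longleftrightarrow> y \<in> D then g (f x) \<le> g (f y) else g (f y) \<le> g (f x)"
    if "x \<in> X" "y \<in> X" "x \<le> y" for x y
  proof (cases "x \<in> A \<longleftrightarrow> y \<in> A")
    case True
    then have "f x \<le> f y" using f_keeps that by simp
    then show ?thesis using True g_keeps[of x y] g_swaps[of x y] that by (auto simp: D_def)
  next
    case False
    then have "f y \<le> f x" using f_swaps that by simp
    then show ?thesis using False g_keeps[of y x] g_swaps[of y x] that by (auto simp: D_def)
  qed
  have A_above: "f b \<le> f a" if "a \<in> X" "a \<in> A" "b \<in> X" "b \<notin> A" for a b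
    using that A_lower f_swaps linear by blast
  have Y_lower: "x \<in> Y" if "x \<in> X" "y \<in> X" "x \<le> y" "y \<in> Y" for x y
  proof (cases "\<exists>a\<in>X. a \<in> A \<and> f a \<in> Z")
    case True
    then have Y: "v \<in> Y \<longleftrightarrow> (v \<in> A \<longleftrightarrow> f v \<in> Z)" for v
      by (simp add: Y_def D_def)
    have "f b \<in> Z" if "b \<in> X" "b \<notin> A" for b
      using True A_above Z_lower that by blast
    then have "y \<in> A" "f y \<in> Z" using Y that by blast+
    moreover from this have "x \<in> A" using A_lower that by blast
    ultimately show ?thesis using Y f_keeps Z_lower that by blast
  next
    case False
    then have Y: "v \<in> Y \<longleftrightarrow> \<not> (v \<in> A \<longleftrightarrow> f v \<in> Z)" for v
      by (auto simp: Y_def D_def)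
    show ?thesis
    proof (cases "x \<in> A")
      case True
      then show ?thesis using Y False that by blast
    next
      case xA: False
      then have "y \<notin> A" using A_lower that by blast
      then have "f y \<in> Z" using Y that by blast
      then have "f x \<in> Z" using f_keeps Z_lower that xA \<open>y \<notin> A\<close> by blast
      then show ?thesis using Y xA by blast
    qed
  qed
  have "(y \<in> Y \<longrightarrow> x \<in> Y) \<and>
      (if x \<in> Y \<longleftrightarrow> y \<in> Y then (g \<circ> f) x \<le> (g \<circ> f) y else (g \<circ> f) y \<le> (g \<circ> f) x)"
    if "x \<in> X" "y \<in> X" "x \<le> y" for x y
    using reversal[OF that] Y_lower[OF that] by (auto simp: Y_def)
  then show ?thesis
    unfolding orientation_preserving_on_iff_reversal by blast
qed

text \<open>
  If \<open>Y\<close> separates the pairs that \<open>f\<close> reverses, the set \<open>L\<close> of values taken outside \<open>Y\<close> is a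
  lower part of the image. A section that inverts \<open>f\<close> outside \<open>Y\<close> on \<open>L\<close>, and
  necessarily inside \<open>Y\<close> elsewhere, reverses exactly the pairs separated by \<open>L\<close>.
\<close>

lemma orientation_preserving_section:
  assumes "orientation_preserving_on X f"
  obtains s where "orientation_preserving_on (f ` X) s"
    and "\<And>v. v \<in> f ` X \<Longrightarrow> s v \<in> X" and "\<And>v. v \<in> f ` X \<Longrightarrow> f (s v) = v"
proof -
  obtain Y where Y: "\<forall>x\<in>X. \<forall>y\<in>X. x \<le> y \<longrightarrow>
      (y \<in> Y \<longrightarrow> x \<in> Y) \<and> (if x \<in> Y \<longleftrightarrow> y \<in> Y then f x \<le> f y else f y \<le> f x)"
    using assms unfolding orientation_preserving_on_iff_reversal by blast
  then have
    Y_lower: "\<And>x y. x \<in> X \<Longrightarrow> y \<in> X \<Longrightarrow> x \<le> y \<Longrightarrow> y \<in> Y \<Longrightarrow> x \<in> Y" and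
    f_keeps: "\<And>x y. x \<in> X \<Longrightarrow> y \<in> X \<Longrightarrow> x \<le> y \<Longrightarrow> x \<in> Y \<longleftrightarrow> y \<in> Y \<Longrightarrow> f x \<le> f y" and
    f_swaps: "\<And>x y. x \<in> X \<Longrightarrow> y \<in> X \<Longrightarrow> x \<le> y \<Longrightarrow> \<not> (x \<in> Y \<longleftrightarrow> y \<in> Y) \<Longrightarrow> f y \<le> f x"
    by simp_all
  define L where "L = f ` (X - Y)"
  define s where "s v = (if v \<in> L then inv_into (X - Y) f v else inv_into X f v)" for v
  have s: "s v \<in> X" "f (s v) = v" "s v \<in> Y \<longleftrightarrow> v \<notin> L" if "v \<in> f ` X" for v
  proof -
    show "s v \<in> X" "f (s v) = v"
      using that inv_into_into[of v f "X - Y"] f_inv_into_f[of v f "X - Y"]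
      by (auto simp: s_def L_def inv_into_into f_inv_into_f)
    then have "v \<in> L" if "s v \<notin> Y"
      using that unfolding L_def by (metis DiffI imageI)
    moreover have "s v \<notin> Y" if "v \<in> L"
      using that inv_into_into[of v f "X - Y"] by (simp add: s_def L_def)
    ultimately show "s v \<in> Y \<longleftrightarrow> v \<notin> L" by blast
  qed
  have Y_below: "a \<le> b \<and> f b \<le> f a" if "a \<in> X" "a \<in> Y" "b \<in> X" "b \<notin> Y" for a b
    using that Y_lower f_swaps linear by blast
  have "(w \<in> L \<longrightarrow> v \<in> L) \<and> (if v \<in> L \<longleftrightarrow> w \<in> L then s v \<le> s w else s w \<le> s v)"
    if vw: "v \<in> f ` X" "w \<in> f ` X" "v \<le> w" for v w
  proof -
    note sv = s[OF vw(1)] and sw = s[OF vw(2)]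
    have lower: "v \<in> L" if "w \<in> L"
    proof (rule ccontr)
      assume "v \<notin> L"
      then have "w \<le> v"
        using Y_below[of "s v" "s w"] sv sw that by simp
      then show False using \<open>v \<le> w\<close> \<open>v \<notin> L\<close> that by simp
    qed
    moreover have "s v \<le> s w" if "v \<in> L \<longleftrightarrow> w \<in> L"
    proof (rule ccontr)
      assume "\<not> s v \<le> s w"
      then have "w \<le> v" using f_keeps[of "s w" "s v"] sv sw that by simp
      then show False using \<open>v \<le> w\<close> \<open>\<not> s v \<le> s w\<close> by simp
    qed
    moreover have "s w \<le> s v" if "\<not> (v \<in> L \<longleftrightarrow> w \<in> L)"
      using Y_below[of "s w" "s v"] sv sw lower that by blast
    ultimately show ?thesis by simp
  qed
  then have "orientation_preserving_on (f ` X) s"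
    unfolding orientation_preserving_on_iff_reversal by blast
  with s show ?thesis using that by blast
qed

lemma left_multiple_iff_image_subset:
  assumes "\<alpha> \<in> carrier (OP X)" and "\<beta> \<in> carrier (OP X)"
  shows "(\<exists>\<gamma>\<in>carrier (OP X). \<alpha> = \<gamma> \<otimes>\<^bsub>OP X\<^esub> \<beta>) \<longleftrightarrow> \<alpha> ` X \<subseteq> \<beta> ` X"
proof
  assume "\<exists>\<gamma>\<in>carrier (OP X). \<alpha> = \<gamma> \<otimes>\<^bsub>OP X\<^esub> \<beta>"
  then show "\<alpha> ` X \<subseteq> \<beta> ` X"
    by (auto simp: OP_def OP_set_def compose_eq)
next
  assume sub: "\<alpha> ` X \<subseteq> \<beta> ` X"
  have \<alpha>: "\<alpha> \<in> extensional X" "orientation_preserving_on X \<alpha>"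
    and \<beta>: "orientation_preserving_on X \<beta>"
    using assms by (auto simp: OP_def OP_set_def PiE_def)
  obtain s where s: "orientation_preserving_on (\<beta> ` X) s"
    "\<And>v. v \<in> \<beta> ` X \<Longrightarrow> s v \<in> X" "\<And>v. v \<in> \<beta> ` X \<Longrightarrow> \<beta> (s v) = v"
    using orientation_preserving_section[OF \<beta>] by blast
  define \<gamma> where "\<gamma> = restrict (s \<circ> \<alpha>) X"
  have "orientation_preserving_on (\<alpha> ` X) s"
    using s(1) sub unfolding orientation_preserving_on_iff_reversal by (meson subsetD)
  with \<alpha>(2) have "orientation_preserving_on X (s \<circ> \<alpha>)"
    by (rule orientation_preserving_on_comp)
  then have "orientation_preserving_on X \<gamma>"
    unfolding orientation_preserving_on_iff_reversal \<gamma>_def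
    by (simp only: restrict_apply' cong: ball_cong)
  then have "\<gamma> \<in> carrier (OP X)"
    using s(2) sub by (auto simp: OP_def OP_set_def \<gamma>_def)
  moreover have "\<alpha> = \<gamma> \<otimes>\<^bsub>OP X\<^esub> \<beta>"
  proof (rule extensionalityI[OF \<alpha>(1)])
    show "\<gamma> \<otimes>\<^bsub>OP X\<^esub> \<beta> \<in> extensional X" by (simp add: OP_def compose_def)
    show "\<alpha> x = (\<gamma> \<otimes>\<^bsub>OP X\<^esub> \<beta>) x" if "x \<in> X" for x
      using that s(3)[of "\<alpha> x"] sub by (auto simp: OP_def compose_eq \<gamma>_def)
  qed
  ultimately show "\<exists>\<gamma>\<in>carrier (OP X). \<alpha> = \<gamma> \<otimes>\<^bsub>OP X\<^esub> \<beta>"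
    by blast
qed

theorem theorem4p3:
  fixes X :: "'a::linorder set" and \<alpha> \<beta> :: "'a \<Rightarrow> 'a"
  assumes "\<alpha> \<in> carrier (OP X)" and "\<beta> \<in> carrier (OP X)"
  shows "green_L (OP X) \<alpha> \<beta> \<longleftrightarrow> \<alpha> ` X = \<beta> ` X"
  using monoid.green_L_iff[OF monoid_OP assms]
    left_multiple_iff_image_subset[OF assms]
    left_multiple_iff_image_subset[OF assms(2,1)]
  by blast

end
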